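(* Let $n\in\mathbb{N}$ be arbitrary (with $n\gg k$), and let $k$ with $\frac{k}{2}\in\mathbb{N}$ and $p\in[0,1]$ be fixed. Let $A_n$ be the adjacency matrix of the small-world random graph $SW(n,k,p)$. Then the first and second moments of the eigenvalue distribution are $$\frac{1}{n}\mathrm{Tr}(A_n) = 0 \qquad\text{and}\qquad \frac{1}{n}\mathrm{Tr}(A_n^2) = k .$$
   Context: The small-world (Watts-Strogatz) random graph $SW(n,k,p)$, with parameters $n\in\mathbb{N}$ (number of vertices), $k\in 2\mathbb{N}$ (degree of the initial lattice) and $p\in[0,1]$ (rewiring probability), where it is assumed that $n\gg k$, is constructed as follows. The vertex set is $\{1,\dots,n\}$, and $i\pm d$ is read modulo $n$. Start from the undirected regular ring lattice of degree $k$, in which each vertex $i$ is adjacent exactly to $i\pm 1,\dots,i\pm\frac{k}{2}$. Consider the vertices $i=1,2,\dots,n$ in order, each once, and for each $i$ consider the edges $\{i,j\}$ for $j=i+1,i+2,\dots,i+\frac{k}{2}$ in order. With probability $1-p$ the edge $\{i,j\}$ is kept; otherwise (with probability $p$, independently) a vertex $j'$ is chosen uniformly at random from $\{1,\dots,n\}\setminus\big(\{i-\frac{k}{2},\dots,i-1,i,i+1,\dots,i+\frac{k}{2}\}\cup\mathbf{N}(i)\big)$, where $\mathbf{N}(i)$ is the set of all vertices $v$ such that the edge $\{i,v\}$ is in the graph, and the edge $\{i,j\}$ is replaced by $\{i,j'\}$. The output is $SW(n,k,p)$. The adjacency matrix $A_n=(A_{ij})$ is the $n\times n$ matrix with $A_{ij}=1$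 if the edge $\{i,j\}$ is in the graph and $A_{ij}=0$ otherwise. $\mathrm{Tr}$ denotes the trace; $\frac1n\mathrm{Tr}(A_n^l)=\frac1n\sum_{i=1}^n\lambda_i^l$, where $\lambda_1,\dots,\lambda_n$ are the eigenvalues of $A_n$. *)

theory Defs
  imports "HOL-Probability.Probability" "Jordan_Normal_Form.Char_Poly"
begin

text \<open>
  Vertices are \<open>0, \<dots>, n - 1\<close> instead of \<open>1, \<dots>, n\<close> (vertex \<open>v\<close> here is the usual vertex
  \<open>v + 1\<close>, so the order in which vertices are processed is unchanged). A graph is given by its set
  of edges, each edge being a two-element set of vertices.
\<close>

definition ring_lattice :: "nat \<Rightarrow> nat \<Rightarrow> nat set set" where
  "ring_lattice n k = {{i, (i + d) mod n} | i d. i < n \<and> d \<in> {1..k div 2}}"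

text \<open>
  The set \<open>{i - k/2, \<dots>, i, \<dots>, i + k/2}\<close> modulo \<open>n\<close>; \<open>j\<close> equals \<open>i - d\<close> modulo \<open>n\<close> iff
  \<open>i\<close> equals \<open>j + d\<close> modulo \<open>n\<close>, which avoids subtraction on the natural numbers.
\<close>

definition ring_window :: "nat \<Rightarrow> nat \<Rightarrow> nat \<Rightarrow> nat set" where
  "ring_window n k i = {j. j < n \<and> (\<exists>d \<le> k div 2. j = (i + d) mod n \<or> i = (j + d) mod n)}"

definition nbrs :: "nat set set \<Rightarrow> nat \<Rightarrow> nat set" where
  "nbrs E i = {v. {i, v} \<in> E}"

definition rewire_targets :: "nat \<Rightarrow> nat \<Rightarrow> nat set set \<Rightarrow> nat \<Rightarrow> nat set" where
  "rewire_targets n k E i = {..<n} - (ring_window n k i \<union> nbrs E i)"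

text \<open>
  Treatment of the edge \<open>{i, i + d}\<close>. The set of admissible new endpoints can be empty with positive
  probability however large \<open>n\<close> is (e.g. for \<open>k = 2\<close>, if every vertex not adjacent to the last
  one in the lattice has rewired to it before it is processed). In that case no rewiring is
  possible and the edge is kept.
\<close>

definition rewire_edge ::
  "nat \<Rightarrow> nat \<Rightarrow> real \<Rightarrow> nat \<times> nat \<Rightarrow> nat set set \<Rightarrow> nat set set pmf" where
  "rewire_edge n k p = (\<lambda>(i, d) E.
     bind_pmf (bernoulli_pmf p) (\<lambda>b.
       if b \<and> rewire_targets n k E i \<noteq> {}
       then map_pmf (\<lambda>j'. insert {i, j'} (E - {{i, (i + d) mod n}}))
              (pmf_of_set (rewire_targets n k E i))
       else return_pmf E))"

primrec rewire_edges ::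
  "nat \<Rightarrow> nat \<Rightarrow> real \<Rightarrow> (nat \<times> nat) list \<Rightarrow> nat set set \<Rightarrow> nat set set pmf" where
  "rewire_edges n k p [] E = return_pmf E"
| "rewire_edges n k p (x # xs) E = bind_pmf (rewire_edge n k p x E) (rewire_edges n k p xs)"

text \<open>
  \<^const>\<open>List.product\<close> is ordered lexicographically: vertices in order, and for each vertex the
  offsets \<open>1, \<dots>, k/2\<close> in order.
\<close>

definition small_world :: "nat \<Rightarrow> nat \<Rightarrow> real \<Rightarrow> nat set set pmf" where
  "small_world n k p =
     rewire_edges n k p (List.product [0..<n] [1..<Suc (k div 2)]) (ring_lattice n k)"

definition adjacency_matrix :: "nat \<Rightarrow> nat set set \<Rightarrow> real mat" where
  "adjacency_matrix n E = mat n n (\<lambda>(i, j). if {i, j} \<in> E then 1 else 0)"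

definition mat_trace :: "'a :: comm_monoid_add mat \<Rightarrow> 'a" where
  "mat_trace A = (\<Sum>i<dim_row A. A $$ (i, i))"

text \<open>
  The eigenvalue distribution puts mass \<open>1/n\<close> on each of the \<open>n\<close> eigenvalues, which are
  the complex roots of the characteristic polynomial, counted with multiplicity.
\<close>

definition eigenvalue_distribution :: "real mat \<Rightarrow> complex pmf" where
  "eigenvalue_distribution A = pmf_of_multiset (proots (char_poly (map_mat complex_of_real A)))"

definition eigenvalue_moment :: "real mat \<Rightarrow> nat \<Rightarrow> complex" where
  "eigenvalue_moment A l = measure_pmf.expectation (eigenvalue_distribution A) (\<lambda>x. x ^ l)"

end

theory Submission
  imports Defs "Jordan_Normal_Form.Schur_Decomposition"
begin

text \<open>
  Rewiring never changes the number of edges: distinct pairs \<open>(i, d)\<close> give distinct lattice edges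
  as \<open>k < n\<close>, so each lattice edge is still present when its turn comes, and its replacement is
  neither a loop nor already present. Hence every possible outcome is a loop-free graph with
  \<open>n k / 2\<close> edges, and the traces of \<open>A\<close> and \<open>A\<^sup>2\<close> count loops and ordered pairs of adjacent
  vertices. Schur triangularisation over the complex numbers turns eigenvalue moments into traces
  of powers.
\<close>

section \<open>Eigenvalue moments and traces of powers\<close>

lemma mat_trace_mult:
  assumes "A \<in> carrier_mat n m" and "B \<in> carrier_mat m n"
  shows "mat_trace (A * B) = (\<Sum>i<n. \<Sum>j<m. A $$ (i, j) * B $$ (j, i))"
  using assms
  by (auto simp: mat_trace_def scalar_prod_def atLeast0LessThan intro!: sum.cong)

lemma mat_trace_mult_commute:
  fixes A B :: "'a :: comm_semiring_0 mat"
  assumes "A \<in> carrier_mat n m" and "B \<in> carrier_mat m n"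
  shows "mat_trace (A * B) = mat_trace (B * A)"
  unfolding mat_trace_mult[OF assms] mat_trace_mult[OF assms(2,1)]
  by (subst sum.swap) (simp add: mult.commute)

text \<open>With \<open>A = P * B * Q\<close>, the factor \<open>P\<close> can be moved cyclically
  to the end of the product, where \<open>Q * P\<close> is the identity.\<close>

lemma mat_trace_similar:
  fixes A B :: "'a :: comm_semiring_1 mat"
  assumes "similar_mat_wit A B P Q"
  shows "mat_trace A = mat_trace B"
proof -
  note wit = similar_mat_witD[OF refl assms]
  have "mat_trace A = mat_trace (P * (B * Q))"
    using wit(3) assoc_mult_mat[OF wit(6,5,7)] by simp
  also have "\<dots> = mat_trace (B * Q * P)"
    by (rule mat_trace_mult_commute[OF wit(6) mult_carrier_mat[OF wit(5,7)]])
  also have "B * Q * P = B"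
    using wit(2,5) assoc_mult_mat[OF wit(5,7,6)] by simp
  finally show ?thesis .
qed

text \<open>On or below the diagonal, \<open>A $$ (i, l)\<close> vanishes for \<open>l < i\<close>
  and \<open>B $$ (l, j)\<close> for \<open>l > i\<close>, so at most the summand
  \<open>l = i\<close> survives, and that one vanishes too when \<open>j < i\<close>.\<close>

lemma upper_triangular_mult_index:
  fixes A B :: "'a :: semiring_0 mat"
  assumes A: "A \<in> carrier_mat n n" "upper_triangular A"
    and B: "B \<in> carrier_mat n n" "upper_triangular B"
    and ij: "j \<le> i" "i < n"
  shows "(A * B) $$ (i, j) = (if i = j then A $$ (i, i) * B $$ (i, i) else 0)"
proof -
  have "(A * B) $$ (i, j) = (\<Sum>l<n. A $$ (i, l) * B $$ (l, j))"
    using A B ij by (simp add: scalar_prod_def atLeast0LessThan)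
  also have "\<dots> = (\<Sum>l<n. if l = i then (if i = j then A $$ (i, i) * B $$ (i, i) else 0) else 0)"
  proof (intro sum.cong refl)
    fix l assume l: "l \<in> {..<n}"
    consider "l < i" | "l = i" | "i < l" by linarith
    then show "A $$ (i, l) * B $$ (l, j) =
        (if l = i then (if i = j then A $$ (i, i) * B $$ (i, i) else 0) else 0)"
      using A B ij l upper_triangularD[of A l i] upper_triangularD[of B j l]
      by cases auto
  qed
  also have "\<dots> = (if i = j then A $$ (i, i) * B $$ (i, i) else 0)"
    using ij by simp
  finally show ?thesis .
qed

lemma upper_triangular_pow:
  fixes B :: "'a :: semiring_1 mat"
  assumes "B \<in> carrier_mat n n" and "upper_triangular B"
  shows "upper_triangular (B ^\<^sub>m l) \<and> (\<forall>i<n. (B ^\<^sub>m l) $$ (i, i) = (B $$ (i, i)) ^ l)"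
proof (induction l)
  case 0
  then show ?case using assms by auto
next
  case (Suc l)
  \<comment> \<open>One formula serves both claims: the case \<open>j < i\<close> gives
    triangularity, the case \<open>j = i\<close> the diagonal powers.\<close>
  have idx: "(B ^\<^sub>m l * B) $$ (i, j) =
      (if i = j then (B ^\<^sub>m l) $$ (i, i) * B $$ (i, i) else 0)" if "j \<le> i" "i < n" for i j
    using upper_triangular_mult_index[OF pow_carrier_mat[OF assms(1)] _ assms that] Suc by blast
  show ?case
  proof
    show "upper_triangular (B ^\<^sub>m Suc l)"
      using assms(1) idx by (intro upper_triangularI) auto
    show "\<forall>i<n. (B ^\<^sub>m Suc l) $$ (i, i) = (B $$ (i, i)) ^ Suc l"
      using idx Suc by (simp add: power_commutes)
  qed
qed

lemma proots_prod_linear_factors: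
  fixes xs :: "'a :: idom list"
  shows "proots (\<Prod>a\<leftarrow>xs. [:- a, 1:]) = mset xs"
proof (induction xs)
  case (Cons a xs)
  have "(\<Prod>a\<leftarrow>xs. [:- a, 1:]) \<noteq> 0"
    by (auto simp: prod_list_zero_iff)
  with Cons show ?case by (simp add: proots_mult del: mult_pCons_left)
qed simp

text \<open>The diagonal of a Schur form \<open>B\<close> of \<open>A\<close> lists the eigenvalues
  with multiplicity, and the diagonal of \<open>B ^\<^sub>m l\<close> their powers. Similarity
  passes to powers, so the traces of \<open>B ^\<^sub>m l\<close> and \<open>A ^\<^sub>m l\<close>
  agree.\<close>

lemma sum_proots_char_poly_pow:
  fixes A :: "complex mat"
  assumes A: "A \<in> carrier_mat n n"
  shows "(\<Sum>x\<in>#proots (char_poly A). x ^ l) = mat_trace (A ^\<^sub>m l)"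
proof -
  obtain as where as: "char_poly A = (\<Prod>a\<leftarrow>as. [:- a, 1:])"
    using char_poly_factorized[OF A] by blast
  define B where "B = schur_upper_triangular A as"
  have B: "B \<in> carrier_mat n n" and tri: "upper_triangular B" and sim: "similar_mat A B"
    unfolding B_def using schur_upper_triangular[OF A as] by auto
  obtain P Q where wit: "similar_mat_wit A B P Q"
    using sim unfolding similar_mat_def by blast
  have "char_poly A = (\<Prod>a\<leftarrow>diag_mat B. [:- a, 1:])"
    using char_poly_similar[OF sim] char_poly_upper_triangular[OF B tri] by simp
  also have "proots \<dots> = mset (diag_mat B)"
    by (rule proots_prod_linear_factors)
  finally have "(\<Sum>x\<in>#proots (char_poly A). x ^ l) = (\<Sum>x\<leftarrow>diag_mat B. x ^ l)"
    by (simp flip: sum_mset_sum_list add: mset_map)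
  also have "\<dots> = (\<Sum>i<n. (B $$ (i, i)) ^ l)"
    using B by (simp add: diag_mat_def o_def interv_sum_list_conv_sum_set_nat atLeast0LessThan)
  also have "\<dots> = mat_trace (B ^\<^sub>m l)"
    using B upper_triangular_pow[OF B tri, of l] by (simp add: mat_trace_def)
  also have "\<dots> = mat_trace (A ^\<^sub>m l)"
    using mat_trace_similar[OF similar_mat_wit_pow[OF wit]] by simp
  finally show ?thesis .
qed

lemma expectation_pmf_of_multiset:
  fixes f :: "'a \<Rightarrow> 'b :: {banach, second_countable_topology, real_normed_field}"
  assumes "M \<noteq> {#}"
  shows "measure_pmf.expectation (pmf_of_multiset M) f = (\<Sum>x\<in>#M. f x) / of_nat (size M)"
proof -
  \<comment> \<open>Grouping equal elements yields the shape of an integral against a finitely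
    supported \<open>pmf\<close>, whose weights are multiplicities divided by
    \<open>size M\<close>.\<close>
  have count: "(\<Sum>x\<in>#M. f x) = (\<Sum>x\<in>set_mset M. of_nat (count M x) * f x)"
  proof (induction M)
    case (add x M)
    have "(\<Sum>y\<in>set_mset (add_mset x M). of_nat (count (add_mset x M) y) * f y) =
        (\<Sum>y\<in>set_mset (add_mset x M). (if y = x then f y else 0) + of_nat (count M y) * f y)"
      by (intro sum.cong) (auto simp: algebra_simps)
    also have "\<dots> = f x + (\<Sum>y\<in>insert x (set_mset M). of_nat (count M y) * f y)"
      by (simp add: sum.distrib)
    \<comment> \<open>If \<open>x\<close> is new to \<open>M\<close>, its summand is zero because
      \<open>count M x = 0\<close>.\<close>
    also have "(\<Sum>y\<in>insert x (set_mset M). of_nat (count M y) * f y) =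
        (\<Sum>y\<in>set_mset M. of_nat (count M y) * f y)"
      by (rule sum.mono_neutral_right) (auto simp: not_in_iff)
    finally show ?case using add by simp
  qed simp
  have "measure_pmf.expectation (pmf_of_multiset M) f =
      (\<Sum>x\<in>set_mset M. pmf (pmf_of_multiset M) x *\<^sub>R f x)"
    using assms by (intro integral_measure_pmf) auto
  also have "\<dots> = (\<Sum>x\<in>#M. f x) / of_nat (size M)"
    using assms by (simp add: count scaleR_conv_of_real sum_divide_distrib)
  finally show ?thesis .
qed

lemma eigenvalue_moment_eq_mat_trace:
  assumes A: "A \<in> carrier_mat n n" and "n > 0"
  shows "eigenvalue_moment A l = complex_of_real (1 / real n * mat_trace (A ^\<^sub>m l))"
proof -
  define C where "C = map_mat complex_of_real A"
  have C: "C \<in> carrier_mat n n" using A by (simp add: C_def)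
  \<comment> \<open>Over the complex numbers the number of roots with multiplicity is the degree, so
    the distribution really has weights \<open>1/n\<close>.\<close>
  have size: "size (proots (char_poly C)) = n"
    using degree_monic_char_poly[OF C] by (simp add: size_proots_complex)
  with \<open>n > 0\<close> have "proots (char_poly C) \<noteq> {#}" by auto
  then have "eigenvalue_moment A l = mat_trace (C ^\<^sub>m l) / of_nat n"
    unfolding eigenvalue_moment_def eigenvalue_distribution_def C_def[symmetric]
    by (simp add: expectation_pmf_of_multiset size sum_proots_char_poly_pow[OF C])
  also have "C ^\<^sub>m l = map_mat complex_of_real (A ^\<^sub>m l)"
    unfolding C_def by (rule of_real_hom.mat_hom_pow[OF A, symmetric])
  also have "mat_trace \<dots> = complex_of_real (mat_trace (A ^\<^sub>m l))"
    using A by (simp add: mat_trace_def)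
  finally show ?thesis by simp
qed

section \<open>Graphs and traces\<close>

definition graph_edges :: "nat \<Rightarrow> nat set set" where
  "graph_edges n = {e. e \<subseteq> {..<n} \<and> card e = 2}"

lemma finite_graph_edges: "finite (graph_edges n)"
  by (rule finite_subset[of _ "Pow {..<n}"]) (auto simp: graph_edges_def)

lemma doubleton_in_graph_edges: "{i, j} \<in> graph_edges n \<longleftrightarrow> i < n \<and> j < n \<and> i \<noteq> j"
  by (auto simp: graph_edges_def card_insert_if)

lemma mat_trace_adjacency_matrix:
  assumes "E \<subseteq> graph_edges n"
  shows "mat_trace (adjacency_matrix n E) = 0"
proof -
  \<comment> \<open>A diagonal entry asks for the edge \<open>{i, i}\<close>, which is the singleton
    \<open>{i}\<close>.\<close>
  have "{i} \<notin> E" for i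
    using assms by (auto simp: graph_edges_def)
  then show ?thesis
    by (simp add: mat_trace_def adjacency_matrix_def)
qed

text \<open>Each edge has exactly two orderings, and different edges have disjoint sets of
  orderings.\<close>

lemma card_ordered_edges:
  assumes "E \<subseteq> graph_edges n"
  shows "card {(i, j). {i, j} \<in> E} = 2 * card E"
proof -
  have two: "card {(i, j). {i, j} = e} = 2" if "card e = 2" for e :: "nat set"
  proof -
    obtain a b where "e = {a, b}" "a \<noteq> b"
      using \<open>card e = 2\<close> by (auto simp: card_2_iff)
    then have "{(i, j). {i, j} = e} = {(a, b), (b, a)}"
      by (auto simp: doubleton_eq_iff)
    with \<open>a \<noteq> b\<close> show ?thesis by simp
  qed
  have E: "finite E" "\<And>e. e \<in> E \<Longrightarrow> card e = 2"
    using assms finite_subset[OF _ finite_graph_edges] by (auto simp: graph_edges_def)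
  have "{(i, j). {i, j} \<in> E} = (\<Union>e\<in>E. {(i, j). {i, j} = e})"
    by auto
  also have "card \<dots> = (\<Sum>e\<in>E. card {(i, j). {i, j} = e})"
    \<comment> \<open>Finiteness of each set of orderings is read off from its cardinality being
      positive.\<close>
    using E two by (intro card_UN_disjoint) (auto intro!: card_ge_0_finite)
  also have "\<dots> = 2 * card E"
    using E two by simp
  finally show ?thesis .
qed

text \<open>The matrix is symmetric with entries 0 and 1, so each product in the double sum is the
  indicator of an ordered pair of adjacent vertices.\<close>

lemma mat_trace_adjacency_matrix_square:
  assumes "E \<subseteq> graph_edges n"
  shows "mat_trace (adjacency_matrix n E ^\<^sub>m 2) = 2 * real (card E)"
proof -
  have A: "adjacency_matrix n E \<in> carrier_mat n n"
    by (simp add: adjacency_matrix_def)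
  have "mat_trace (adjacency_matrix n E ^\<^sub>m 2) =
      (\<Sum>i<n. \<Sum>j<n. adjacency_matrix n E $$ (i, j) * adjacency_matrix n E $$ (j, i))"
    using A by (simp add: numeral_2_eq_2 mat_trace_mult[OF A A])
  also have "\<dots> = (\<Sum>i<n. \<Sum>j<n. if {i, j} \<in> E then 1 else 0)"
    by (intro sum.cong refl) (auto simp: adjacency_matrix_def insert_commute)
  also have "\<dots> = (\<Sum>x\<in>{..<n} \<times> {..<n}. if (\<lambda>(i, j). {i, j} \<in> E) x then 1 else 0)"
    by (simp add: sum.cartesian_product case_prod_unfold)
  also have "\<dots> = real (card ({..<n} \<times> {..<n} \<inter> {x. (\<lambda>(i, j). {i, j} \<in> E) x}))"
    by (subst sum.inter_filter[symmetric]) (auto simp: Int_def)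
  also have "{..<n} \<times> {..<n} \<inter> {x. (\<lambda>(i, j). {i, j} \<in> E) x} = {(i, j). {i, j} \<in> E}"
    using assms doubleton_in_graph_edges by blast
  finally show ?thesis
    using card_ordered_edges[OF assms] by simp
qed

section \<open>Rewiring preserves the number of edges\<close>

text \<open>Separates the index \<open>(i, d)\<close> used by the rewiring process from the edge it
  denotes, so that distinctness of the edges becomes injectivity.\<close>

definition lattice_edge :: "nat \<Rightarrow> nat \<times> nat \<Rightarrow> nat set" where
  "lattice_edge n = (\<lambda>(i, d). {i, (i + d) mod n})"

lemma ring_lattice_eq_image: "ring_lattice n k = lattice_edge n ` ({..<n} \<times> {1..k div 2})"
  by (auto simp: ring_lattice_def lattice_edge_def image_iff) blast

lemma add_mod_eq: "a < n \<Longrightarrow> b < n \<Longrightarrow> (a + b) mod n = (if a + b < n then a + b else a + b - n)"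
  for a b n :: nat
  by (simp add: mod_if)

text \<open>Two indices of the same edge either share their first vertex, and then
  \<open>d = d'\<close> since both are below \<open>n\<close>, or traverse the edge in opposite
  directions. The latter would make \<open>n\<close> divide \<open>d + d'\<close>, but
  \<open>0 < d + d' \<le> k < n\<close>.\<close>

lemma inj_on_lattice_edge:
  assumes "k < n"
  shows "inj_on (lattice_edge n) ({..<n} \<times> {1..k div 2})"
proof (rule inj_onI, unfold split_paired_all)
  fix i d i' d'
  assume mem: "(i, d) \<in> {..<n} \<times> {1..k div 2}" "(i', d') \<in> {..<n} \<times> {1..k div 2}"
    and eq: "lattice_edge n (i, d) = lattice_edge n (i', d')"
  from mem have i: "i \<in> {..<n}" "i' \<in> {..<n}" and d: "d \<in> {1..k div 2}" "d' \<in> {1..k div 2}"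
    by auto
  have "d < n" "d' < n" using assms d by auto
  with i have mod: "(i + d) mod n = (if i + d < n then i + d else i + d - n)"
    "(i' + d') mod n = (if i' + d' < n then i' + d' else i' + d' - n)"
    by (simp_all add: add_mod_eq)
  have "d + d' < n" "d > 0" "d' > 0" using assms d by auto
  moreover have "i = i' \<and> (i + d) mod n = (i' + d') mod n \<or>
      i = (i' + d') mod n \<and> (i + d) mod n = i'"
    using eq by (auto simp: lattice_edge_def doubleton_eq_iff)
  ultimately show "(i, d) = (i', d')"
    using i unfolding mod by (auto split: if_splits)
qed

lemma card_ring_lattice: "k < n \<Longrightarrow> card (ring_lattice n k) = n * (k div 2)"
  unfolding ring_lattice_eq_image
  by (subst card_image[OF inj_on_lattice_edge]) auto

lemma lattice_edge_in_graph_edges: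
  assumes "k < n" and "x \<in> {..<n} \<times> {1..k div 2}"
  shows "lattice_edge n x \<in> graph_edges n"
proof -
  obtain i d where x: "x = (i, d)" "i < n" "0 < d" "d < n"
    using assms by (cases x) auto
  then have "(i + d) mod n \<noteq> i"
    by (auto simp: add_mod_eq)
  with x show ?thesis
    by (simp add: lattice_edge_def doubleton_in_graph_edges)
qed

text \<open>The removed edge lies in \<open>E\<close> and the inserted one does not, so the count is
  unchanged. The last conclusion says that no other edge is lost, which keeps later lattice edges
  available.\<close>

lemma set_pmf_rewire_edge:
  assumes "E' \<in> set_pmf (rewire_edge n k p x E)" and "E \<subseteq> graph_edges n"
    and "x \<in> {..<n} \<times> {1..k div 2}" and "lattice_edge n x \<in> E"
  shows "E' \<subseteq> graph_edges n" and "card E' = card E" and "E - {lattice_edge n x} \<subseteq> E'"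
proof -
  obtain i d where x: "x = (i, d)" "i < n" using assms by (cases x) auto
  have fin: "finite (rewire_targets n k E i)" by (simp add: rewire_targets_def)
  \<comment> \<open>The case \<open>E' = E\<close> covers both a kept edge and an empty set of
    targets.\<close>
  have "E' = E \<or> (\<exists>j\<in>rewire_targets n k E i. E' = insert {i, j} (E - {lattice_edge n x}))"
    using assms(1) fin unfolding rewire_edge_def x lattice_edge_def
    by (cases "rewire_targets n k E i = {}") (auto split: if_splits)
  then have "E' \<subseteq> graph_edges n \<and> card E' = card E \<and> E - {lattice_edge n x} \<subseteq> E'"
  proof
    assume "E' = E"
    then show ?thesis using assms(2) by auto
  next
    assume "\<exists>j\<in>rewire_targets n k E i. E' = insert {i, j} (E - {lattice_edge n x})"
    then obtain j where j: "j \<in> rewire_targets n k E i"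
      and E': "E' = insert {i, j} (E - {lattice_edge n x})" by blast
    \<comment> \<open>Offset 0 puts \<open>i\<close> into its own window, so a target
      \<open>j\<close> differs from \<open>i\<close> and no loop arises.\<close>
    have "i \<in> ring_window n k i"
      using \<open>i < n\<close> by (auto simp: ring_window_def intro!: exI[of _ 0])
    then have new: "{i, j} \<in> graph_edges n" "{i, j} \<notin> E"
      using j \<open>i < n\<close> by (auto simp: rewire_targets_def nbrs_def doubleton_in_graph_edges)
    have "finite E"
      using assms(2) finite_subset finite_graph_edges by blast
    then have "card E' = card E"
      using assms(4) new(2) card_Suc_Diff1[of E "lattice_edge n x"] by (simp add: E')
    then show ?thesis
      using assms(2) new(1) E' by blast
  qed
  then show "E' \<subseteq> graph_edges n" "card E' = card E" "E - {lattice_edge n x} \<subseteq> E'"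
    by auto
qed

text \<open>The invariant of the induction is that every lattice edge still to be processed is
  present in the current graph.\<close>

lemma set_pmf_rewire_edges:
  assumes "k < n" and "E' \<in> set_pmf (rewire_edges n k p xs E)"
    and "distinct xs" and "set xs \<subseteq> {..<n} \<times> {1..k div 2}"
    and "E \<subseteq> graph_edges n" and "lattice_edge n ` set xs \<subseteq> E"
  shows "E' \<subseteq> graph_edges n \<and> card E' = card E"
  using assms(2-)
proof (induction xs arbitrary: E)
  case (Cons x xs)
  then obtain F where F: "F \<in> set_pmf (rewire_edge n k p x E)"
      "E' \<in> set_pmf (rewire_edges n k p xs F)"
    by auto
  note step = set_pmf_rewire_edge[OF F(1)]
  \<comment> \<open>Injectivity and distinctness ensure that treating \<open>x\<close> cannot remove
    an edge whose turn is yet to come.\<close>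
  have "lattice_edge n x \<notin> lattice_edge n ` set xs"
    using inj_on_subset[OF inj_on_lattice_edge[OF \<open>k < n\<close>] Cons.prems(3)] Cons.prems(2)
    by (auto dest: inj_onD)
  moreover have x: "x \<in> {..<n} \<times> {1..k div 2}" "lattice_edge n x \<in> E"
    using Cons.prems(3,5) by auto
  moreover have "lattice_edge n ` set xs \<subseteq> E"
    using Cons.prems(5) by auto
  ultimately have "lattice_edge n ` set xs \<subseteq> F"
    using step(3)[OF Cons.prems(4)] by blast
  moreover have "F \<subseteq> graph_edges n" "card F = card E"
    using step(1,2)[OF Cons.prems(4) x] by auto
  ultimately show ?case
    using Cons.IH[OF F(2)] Cons.prems by auto
qed auto

lemma set_pmf_small_world:
  assumes "k < n" and "E \<in> set_pmf (small_world n k p)"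
  shows "E \<subseteq> graph_edges n" and "card E = n * (k div 2)"
proof -
  let ?xs = "List.product [0..<n] [1..<Suc (k div 2)]"
  have "set ?xs = {..<n} \<times> {1..k div 2}" by auto
  then have "E \<subseteq> graph_edges n \<and> card E = card (ring_lattice n k)"
    using assms lattice_edge_in_graph_edges[OF assms(1)]
    by (intro set_pmf_rewire_edges[OF assms(1), of _ p ?xs])
      (auto simp: small_world_def ring_lattice_eq_image distinct_product simp del: set_product upt_Suc)
  then show "E \<subseteq> graph_edges n" "card E = n * (k div 2)"
    using card_ring_lattice[OF assms(1)] by auto
qed

theorem theorem3p8:
  fixes n k :: nat and p :: real
  assumes "even k" and "k < n" and "0 \<le> p" and "p \<le> 1"
  shows "AE A in measure_pmf (map_pmf (adjacency_matrix n) (small_world n k p)).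
           eigenvalue_moment A 1 = complex_of_real (1 / real n * mat_trace A) \<and>
           1 / real n * mat_trace A = 0 \<and>
           eigenvalue_moment A 2 = complex_of_real (1 / real n * mat_trace (A ^\<^sub>m 2)) \<and>
           1 / real n * mat_trace (A ^\<^sub>m 2) = real k"
proof -
  \<comment> \<open>The identities hold for every graph in the support, hence almost surely.\<close>
  have "eigenvalue_moment A 1 = complex_of_real (1 / real n * mat_trace A) \<and>
      1 / real n * mat_trace A = 0 \<and>
      eigenvalue_moment A 2 = complex_of_real (1 / real n * mat_trace (A ^\<^sub>m 2)) \<and>
      1 / real n * mat_trace (A ^\<^sub>m 2) = real k"
    if "E \<in> set_pmf (small_world n k p)" and A_def: "A = adjacency_matrix n E" for A E
  proof -
    note E = set_pmf_small_world[OF \<open>k < n\<close> that(1)]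
    have A: "A \<in> carrier_mat n n" and "n > 0"
      using \<open>k < n\<close> by (simp_all add: A_def adjacency_matrix_def)
    have "A ^\<^sub>m 1 = A" using A by simp
    \<comment> \<open>Evenness makes twice the edge count \<open>n * (k div 2)\<close> equal to
      \<open>n * k\<close>.\<close>
    moreover have "2 * (k div 2) = k" using \<open>even k\<close> by simp
    then have "2 * real (card E) = real n * real k"
      unfolding E(2) by (metis mult.left_commute of_nat_mult of_nat_numeral)
    ultimately show ?thesis
      using eigenvalue_moment_eq_mat_trace[OF A \<open>n > 0\<close>, of 1]
        eigenvalue_moment_eq_mat_trace[OF A \<open>n > 0\<close>, of 2]
        mat_trace_adjacency_matrix[OF E(1)] mat_trace_adjacency_matrix_square[OF E(1)] \<open>n > 0\<close>
      by (simp add: A_def)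
  qed
  then show ?thesis
    by (auto simp: AE_measure_pmf_iff)
qed

end
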